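(* Let $f:[0,1]\to[0,1]$ be continuous, let $\{I_j\}_{j=0}^\infty$ be generating intervals with periods $\{m_j\}_{j=0}^\infty=D$, and let $Q=\bigcap_{j\ge 0}\mathrm{orb}\,I_j$. Then there exists a continuous map $\phi:Q\to H(D)$ with the following properties: 1) $\phi$ semiconjugates $f|Q$ to $\tau$ (i.e. $\tau\circ\phi=\phi\circ f$ and $\phi$ is surjective); 2) there exists a unique set $S\subset S_p$ such that $\omega(x)=S$ for any $x\in Q$; moreover, $S$ is the set of all limit points of $S_\Omega$, and $f|S$ is minimal; 3) if $\omega(z)\cap Q\neq\emptyset$ (for $z\in[0,1]$) then $S\subset\omega(z)\subset S_\omega$; 4) for any $\mathbf r\in H(D)$ the set $J=\phi^{-1}(\mathbf r)$ is a connected component of $Q$, and: (a) if $J=\{a\}$ then $a\in S$; (b) if $J=[a,b]$ with $a\neq b$ then $\emptyset\neq S\cap J\subset S_\Omega\cap J\subset\{a,b\}$; 5) $S_\Omega\setminus S$ is at most countable and consists of isolated points; 6) $h(f|Q)=0$.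
   Context: A closed interval $I\subset[0,1]$ is periodic of period $k$ if $I,fI,\dots,f^{k-1}I$ are pairwise disjoint and $f^kI=I$; then $\mathrm{orb}\,I=\bigcup_{i=0}^{k-1}f^iI$. Generating intervals are periodic intervals $I_0\supset I_1\supset\cdots$ with periods $m_0,m_1,\dots$ such that $m_j\to\infty$ (then $m_{j+1}$ is automatically a multiple of $m_j$). For $x\in[0,1]$, $\omega(x)$ is the set of limit points of the forward orbit of $x$; $\omega(f)=\bigcup_x\omega(x)$; $\mathrm{Per}\,f$ is the set of periodic points; $\Omega(f)$ is the set of non-wandering points. Put $S_p=Q\cap\overline{\mathrm{Per}\,f}$, $S_\omega=Q\cap\omega(f)$, $S_\Omega=Q\cap\Omega(f)$. For $D=\{m_j\}$ with $m_{j+1}$ a multiple of $m_j$ and $m_j\to\infty$, $H(D)=\{(r_0,r_1,\dots)\in\mathbb Z_{m_0}\times\mathbb Z_{m_1}\times\cdots: r_{j+1}\equiv r_j \pmod{m_j}\ \forall j\}$ (with the product topology), and $\tau:H(D)\to H(D)$ is the translation by $(1,1,\dots)$. A map $T:X\to X$ is minimal if $\omega(x)=X$ for every $x\in X$. $h$ denotes topological entropy. *)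

theory Defs
  imports "HOL-Analysis.Analysis"
begin

text \<open>
  A self-map of a set \<open>X\<close> is given by a total function \<open>f\<close> with \<open>f ` X \<subseteq> X\<close>; the notions below
  only depend on the values of \<open>f\<close> on \<open>X\<close>. Limit points are taken in the ambient space; for
  closed \<open>X\<close> this agrees with taking them in \<open>X\<close>.
\<close>

section \<open>Periodic and generating intervals\<close>

text \<open>
  One-point intervals are admitted. They cannot occur in a generating sequence: below a one-point
  interval, all periods would be equal, so they would not tend to infinity.
\<close>

definition periodic_interval :: "(real \<Rightarrow> real) \<Rightarrow> real set \<Rightarrow> nat \<Rightarrow> bool" where
  "periodic_interval f I k \<longleftrightarrow>
     (\<exists>a b. a \<le> b \<and> I = {a..b}) \<and> I \<subseteq> {0..1} \<and> k \<ge> 1 \<and>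
     disjoint_family_on (\<lambda>i. (f ^^ i) ` I) {..<k} \<and> (f ^^ k) ` I = I"

definition orb :: "(real \<Rightarrow> real) \<Rightarrow> nat \<Rightarrow> real set \<Rightarrow> real set" where
  "orb f k I = (\<Union>i<k. (f ^^ i) ` I)"

definition generating_intervals ::
    "(real \<Rightarrow> real) \<Rightarrow> (nat \<Rightarrow> real set) \<Rightarrow> (nat \<Rightarrow> nat) \<Rightarrow> bool" where
  "generating_intervals f I m \<longleftrightarrow>
     (\<forall>j. periodic_interval f (I j) (m j)) \<and> (\<forall>j. I (Suc j) \<subseteq> I j) \<and>
     filterlim m at_top sequentially"

section \<open>Limit sets, periodic points, non-wandering points\<close>

text \<open>
  Limit points of the orbit as a sequence, not accumulation points of its range: the limit set of
  a periodic point is its (finite) orbit.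
\<close>

definition omega_limit :: "('a::topological_space \<Rightarrow> 'a) \<Rightarrow> 'a \<Rightarrow> 'a set" where
  "omega_limit f x = {y. \<exists>r::nat \<Rightarrow> nat. strict_mono r \<and> (\<lambda>n. (f ^^ r n) x) \<longlonglongrightarrow> y}"

definition omega_set :: "'a::topological_space set \<Rightarrow> ('a \<Rightarrow> 'a) \<Rightarrow> 'a set" where
  "omega_set X f = (\<Union>x\<in>X. omega_limit f x)"

definition Per :: "'a set \<Rightarrow> ('a \<Rightarrow> 'a) \<Rightarrow> 'a set" where
  "Per X f = {x \<in> X. \<exists>n\<ge>1. (f ^^ n) x = x}"

definition nonwandering :: "'a::topological_space set \<Rightarrow> ('a \<Rightarrow> 'a) \<Rightarrow> 'a set" where
  "nonwandering X f =
     {x \<in> X. \<forall>U. openin (top_of_set X) U \<and> x \<in> U \<longrightarrow> (\<exists>n\<ge>1. (f ^^ n) ` U \<inter> U \<noteq> {})}"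

definition minimal_on :: "'a::topological_space set \<Rightarrow> ('a \<Rightarrow> 'a) \<Rightarrow> bool" where
  "minimal_on X f \<longleftrightarrow> f ` X \<subseteq> X \<and> (\<forall>x\<in>X. omega_limit f x = X)"

section \<open>The group \<open>H(D)\<close> and its translation\<close>

text \<open>The residues modulo \<open>k\<close> are represented by \<open>{0..<k}\<close>.\<close>

definition H :: "(nat \<Rightarrow> nat) \<Rightarrow> (nat \<Rightarrow> nat) set" where
  "H m = {r. (\<forall>j. r j \<in> {0..<m j}) \<and> (\<forall>j. r (Suc j) mod m j = r j mod m j)}"

definition H_topology :: "(nat \<Rightarrow> nat) \<Rightarrow> (nat \<Rightarrow> nat) topology" where
  "H_topology m =
     subtopology (product_topology (\<lambda>j. discrete_topology {0..<m j}) UNIV) (H m)"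

definition translation :: "(nat \<Rightarrow> nat) \<Rightarrow> (nat \<Rightarrow> nat) \<Rightarrow> (nat \<Rightarrow> nat)" where
  "translation m r = (\<lambda>j. (r j + 1) mod m j)"

section \<open>Topological entropy\<close>

definition dyn_separated ::
    "'a::metric_space set \<Rightarrow> ('a \<Rightarrow> 'a) \<Rightarrow> nat \<Rightarrow> real \<Rightarrow> 'a set \<Rightarrow> bool" where
  "dyn_separated X f n \<epsilon> E \<longleftrightarrow>
     E \<subseteq> X \<and> (\<forall>x\<in>E. \<forall>y\<in>E. x \<noteq> y \<longrightarrow> (\<exists>i<n. dist ((f ^^ i) x) ((f ^^ i) y) > \<epsilon>))"

text \<open>
  The Bowen--Dinaburg definition, for \<open>X\<close> compact and \<open>f\<close> continuous on \<open>X\<close>. The growth rate is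
  antimonotone in \<open>\<epsilon>\<close>, so its limit for \<open>\<epsilon>\<close> tending to 0 is the supremum over \<open>\<epsilon> > 0\<close>.
\<close>

definition topological_entropy :: "'a::metric_space set \<Rightarrow> ('a \<Rightarrow> 'a) \<Rightarrow> ereal" where
  "topological_entropy X f =
     (SUP \<epsilon>\<in>{0<..}. limsup (\<lambda>n.
        SUP E\<in>{E. finite E \<and> dyn_separated X f n \<epsilon> E}. ereal (ln (real (card E)) / real n)))"

end

theory Submission
  imports Defs
begin

text \<open>
  Write \<open>K j i = f\<^sup>i(I\<^sub>j)\<close>. Everything rests on one observation: if three points of \<open>Q\<close> with
  different addresses \<open>\<phi>\<close> lie in an interval \<open>U\<close>, then for large \<open>j\<close> the interval \<open>K j i\<close>
  that contains the middle one avoids the outer two, hence lies in \<open>U\<close>. Therefore the set \<open>S\<close> of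
  points all of whose neighbourhoods contain some \<open>K j i\<close> is the limit set of every orbit in \<open>Q\<close>
  (each such orbit visits each \<open>K j i\<close> infinitely often) and the derived set of \<open>S\<^sub>\<Omega>\<close>. The
  fibres of \<open>\<phi>\<close> are wandering intervals, so only their endpoints can be non-wandering. The entropy
  vanishes because, for given \<open>\<epsilon>\<close>, at most \<open>1 + 1/\<epsilon>\<close> of the \<open>m\<^sub>j\<close> intervals \<open>K j i\<close>
  are longer than \<open>\<epsilon>\<close>, and only visits to these can separate two orbits with the same address.
\<close>

section \<open>Limit sets and isolated points\<close>

text \<open>Trades subsequences for visits at arbitrarily late times, the form used below.\<close>

lemma omega_limit_iff:
  fixes f :: "'a::metric_space \<Rightarrow> 'a"
  shows "y \<in> omega_limit f x \<longleftrightarrow> (\<forall>e>0. \<forall>N. \<exists>n\<ge>N. dist ((f ^^ n) x) y < e)"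
proof
  assume "y \<in> omega_limit f x"
  then obtain r :: "nat \<Rightarrow> nat" where r: "strict_mono r" "(\<lambda>n. (f ^^ r n) x) \<longlonglongrightarrow> y"
    by (auto simp: omega_limit_def)
  show "\<forall>e>0. \<forall>N. \<exists>n\<ge>N. dist ((f ^^ n) x) y < e"
  proof (intro allI impI)
    fix e :: real and N
    assume "e > 0"
    then obtain M where "\<And>n. n \<ge> M \<Longrightarrow> dist ((f ^^ r n) x) y < e"
      using r(2) by (auto simp: lim_sequentially)
    then have "dist ((f ^^ r (max M N)) x) y < e" by simp
    moreover have "r (max M N) \<ge> N"
      using seq_suble[OF r(1), of "max M N"] by linarith
    ultimately show "\<exists>n\<ge>N. dist ((f ^^ n) x) y < e" by blast
  qed
next
  assume *: "\<forall>e>0. \<forall>N. \<exists>n\<ge>N. dist ((f ^^ n) x) y < e"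
  \<comment> \<open>Dependent choice: each new time is later than the previous one, and the time of
    index \<open>n\<close> brings the orbit within 1/(n+1) of \<open>y\<close>.\<close>
  have "\<exists>r. \<forall>n. dist ((f ^^ r n) x) y < inverse (real (Suc n)) \<and> r n < r (Suc n)"
  proof (rule dependent_nat_choice)
    show "\<exists>k. dist ((f ^^ k) x) y < inverse (real (Suc 0))"
      using * by (metis inverse_positive_iff_positive of_nat_0_less_iff zero_less_Suc)
    show "\<exists>k'. dist ((f ^^ k') x) y < inverse (real (Suc (Suc n))) \<and> k < k'" for k n
      using *[rule_format, of "inverse (real (Suc (Suc n)))" "Suc k"] by (auto simp: Suc_le_eq)
  qed
  then obtain r where r: "\<And>n. dist ((f ^^ r n) x) y < inverse (real (Suc n))"
      "\<And>n. r n < r (Suc n)"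
    by blast
  have "(\<lambda>n. dist ((f ^^ r n) x) y) \<longlonglongrightarrow> 0"
    by (rule tendsto_sandwich[OF _ _ tendsto_const LIMSEQ_inverse_real_of_nat])
      (use r(1) in \<open>auto intro!: always_eventually less_imp_le simp del: of_nat_Suc\<close>)
  then have "(\<lambda>n. (f ^^ r n) x) \<longlonglongrightarrow> y"
    by (subst tendsto_dist_iff)
  then show "y \<in> omega_limit f x"
    using r(2) by (auto simp: omega_limit_def strict_mono_Suc_iff)
qed

lemma omega_limitD:
  fixes f :: "'a::metric_space \<Rightarrow> 'a"
  assumes "y \<in> omega_limit f x" "open U" "y \<in> U"
  obtains n where "n \<ge> N" "(f ^^ n) x \<in> U"
  using assms unfolding omega_limit_iff by (metis open_dist)

lemma closed_omega_limit:
  fixes f :: "'a::metric_space \<Rightarrow> 'a"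
  shows "closed (omega_limit f x)"
proof -
  have "y \<in> omega_limit f x" if y: "\<forall>e>0. \<exists>z\<in>omega_limit f x. dist z y < e" for y
    unfolding omega_limit_iff
  proof (intro allI impI)
    fix e :: real and N assume "e > 0"
    then obtain z where "z \<in> omega_limit f x" "z \<in> ball y e"
      using y by (auto simp: dist_commute)
    then show "\<exists>n\<ge>N. dist ((f ^^ n) x) y < e"
      by (metis omega_limitD open_ball mem_ball dist_commute)
  qed
  then show ?thesis
    by (auto simp: closure_subset_eq[symmetric] closure_approachable)
qed

text \<open>Limit points are approached at times beyond any \<open>N\<close>, so a tail of the orbit
  suffices.\<close>

lemma omega_limit_subset_closed:
  fixes f :: "'a::metric_space \<Rightarrow> 'a"
  assumes "closed C" "\<And>n. n \<ge> N \<Longrightarrow> (f ^^ n) x \<in> C"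
  shows "omega_limit f x \<subseteq> C"
proof
  fix y assume y: "y \<in> omega_limit f x"
  show "y \<in> C"
  proof (rule ccontr)
    assume "y \<notin> C"
    then obtain n where "n \<ge> N" "(f ^^ n) x \<in> - C"
      using omega_limitD[OF y, of "- C"] assms(1) by auto
    then show False using assms(2) by blast
  qed
qed

lemma omega_limit_forward:
  fixes f :: "'a::metric_space \<Rightarrow> 'a"
  assumes "closed X" "continuous_on X f" "f ` X \<subseteq> X" "x \<in> X" "y \<in> omega_limit f x"
  shows "f y \<in> omega_limit f x"
proof -
  obtain r :: "nat \<Rightarrow> nat" where r: "strict_mono r" "(\<lambda>n. (f ^^ r n) x) \<longlonglongrightarrow> y"
    using assms(5) by (auto simp: omega_limit_def)
  have orbit: "(f ^^ n) x \<in> X" for n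
    using assms(3,4) by (induction n) auto
  then have "y \<in> X"
    using omega_limit_subset_closed[of X] assms(1,5) by blast
  then have "(\<lambda>n. f ((f ^^ r n) x)) \<longlonglongrightarrow> f y"
    using continuous_on_tendsto_compose[OF assms(2) r(2)] orbit by simp
  then have "(\<lambda>n. (f ^^ (Suc \<circ> r) n) x) \<longlonglongrightarrow> f y" by simp
  moreover have "strict_mono (Suc \<circ> r)" using r(1) by (simp add: strict_mono_def)
  ultimately show ?thesis unfolding omega_limit_def by blast
qed

text \<open>A countable basis provides for each isolated point \<open>x\<close> a basic set meeting
  \<open>X\<close> in \<open>x\<close> alone, and such a set determines its point.\<close>

lemma countable_isolated_points:
  fixes X :: "'a::second_countable_topology set"
  shows "countable {x. x isolated_in X}"
proof -
  obtain B :: "'a set set" where B: "countable B" "topological_basis B"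
    using ex_countable_basis by blast
  have "\<exists>U\<in>B. U \<inter> X = {x}" if iso: "x isolated_in X" for x
  proof -
    obtain T where "open T" "T \<inter> X = {x}"
      using iso unfolding isolated_in_def by metis
    moreover from this obtain U where "U \<in> B" "x \<in> U" "U \<subseteq> T"
      using topological_basisE[OF B(2), of T x] by blast
    ultimately show ?thesis by blast
  qed
  then obtain u where u: "\<And>x. x isolated_in X \<Longrightarrow> u x \<in> B \<and> u x \<inter> X = {x}"
    by metis
  have "inj_on u {x. x isolated_in X}"
    by (rule inj_onI) (metis (mono_tags) u mem_Collect_eq singleton_inject)
  moreover have "u ` {x. x isolated_in X} \<subseteq> B" using u by blast
  ultimately show ?thesis
    using B(1) by (meson countable_subset countable_image_inj_on)
qed

lemma mod_add_left_cancel_nat: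
  fixes a b c n :: nat
  assumes "(c + a) mod n = (c + b) mod n"
  shows "a mod n = b mod n"
proof -
  have *: "x mod n = y mod n" if "x \<le> y" "(c + x) mod n = (c + y) mod n" for x y
  proof -
    have "n dvd (c + y) - (c + x)"
      using that by (metis add_le_mono order_refl mod_eq_dvd_iff_nat)
    then have "n dvd y - x" by simp
    then show ?thesis using that(1) by (metis mod_eq_dvd_iff_nat)
  qed
  show ?thesis
    using *[of a b] *[of b a] assms by (metis linorder_le_cases)
qed

lemma infinite_imp_three_less:
  fixes A :: "'a::linorder set"
  assumes "infinite A"
  obtains a b c where "a \<in> A" "b \<in> A" "c \<in> A" "a < b" "b < c"
proof -
  obtain B where "finite B" "card B = 3" "B \<subseteq> A"
    using infinite_arbitrarily_large[OF assms] by blast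
  then obtain x y z where "x \<in> A" "y \<in> A" "z \<in> A" "x \<noteq> y" "y \<noteq> z" "x \<noteq> z"
    by (auto simp: card_3_iff)
  then show thesis using that by (metis linorder_neqE)
qed

section \<open>Generating intervals\<close>

locale solenoidal =
  fixes f :: "real \<Rightarrow> real" and I :: "nat \<Rightarrow> real set" and m :: "nat \<Rightarrow> nat"
  assumes f_cont: "continuous_on {0..1} f"
    and f_maps: "f ` {0..1} \<subseteq> {0..1}"
    and gen: "generating_intervals f I m"
begin

text \<open>The index runs over all naturals; only its residue modulo \<open>m j\<close> matters, so
  \<open>f\<close> acts as \<open>i\<close> to \<open>i + 1\<close> without wrap-around.\<close>

definition K :: "nat \<Rightarrow> nat \<Rightarrow> real set" where
  "K j i = (f ^^ i) ` I j"

definition Q :: "real set" where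
  "Q = (\<Inter>j. orb f (m j) (I j))"

text \<open>The index exists by membership in \<open>Q\<close> and is unique by disjointness; a
  point off \<open>Q\<close> lacks an index at some level.\<close>

definition \<phi> :: "real \<Rightarrow> nat \<Rightarrow> nat" where
  "\<phi> x j = (THE i. i < m j \<and> x \<in> K j i)"

text \<open>The small interval need not contain \<open>y\<close>. Thus an endpoint of a
  nondegenerate fibre can belong to \<open>S\<close>, although every \<open>K j i\<close> through it
  contains the whole fibre.\<close>

definition S :: "real set" where
  "S = {y. \<forall>e>0. \<exists>j i. K j i \<subseteq> ball y e}"

section \<open>The cyclic system of intervals \<open>K j i\<close>\<close>

lemma periodic: "periodic_interval f (I j) (m j)"
  using gen by (simp add: generating_intervals_def)

lemma m_pos [simp]: "0 < m j"
  using periodic[of j] by (simp add: periodic_interval_def)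

lemma m_unbounded: "\<exists>j\<ge>l. n < m j"
proof -
  have "eventually (\<lambda>j. n < m j) sequentially"
    using gen unfolding generating_intervals_def filterlim_at_top
    by (auto dest!: spec[of _ "Suc n"] simp: Suc_le_eq)
  then show ?thesis
    unfolding eventually_sequentially by (metis max.cobounded1 max.cobounded2)
qed

lemma funpow_unit: "x \<in> {0..1} \<Longrightarrow> (f ^^ n) x \<in> {0..1}"
  by (induction n) (use f_maps in \<open>auto simp: image_subset_iff\<close>)

lemma funpow_cont: "continuous_on {0..1} (f ^^ n)"
proof (induction n)
  case (Suc n)
  have "continuous_on ((f ^^ n) ` {0..1}) f"
    using funpow_unit by (intro continuous_on_subset[OF f_cont]) blast
  then show ?case using continuous_on_compose[OF Suc] by simp
qed simp

lemma I_unit: "I j \<subseteq> {0..1}"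
  using periodic[of j] by (auto simp: periodic_interval_def)

lemma K_unit: "K j i \<subseteq> {0..1}"
  unfolding K_def using I_unit funpow_unit by blast

lemma
  shows K_nonempty: "K j i \<noteq> {}"
    and K_compact: "compact (K j i)"
    and K_connected: "connected (K j i)"
proof -
  obtain a b where "a \<le> b" "I j = {a..b}"
    using periodic[of j] by (auto simp: periodic_interval_def)
  then show "K j i \<noteq> {}" "compact (K j i)" "connected (K j i)"
    unfolding K_def using I_unit[of j] funpow_cont[of i]
    by (auto intro!: compact_continuous_image connected_continuous_image
        intro: continuous_on_subset)
qed

lemma K_between:
  assumes "x \<in> K j i" "y \<in> K j i" "x \<le> z" "z \<le> y"
  shows "z \<in> K j i"
  using K_connected assms by (meson connected_contains_Icc atLeastAtMost_iff subsetD)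

lemma funpow_image_K: "(f ^^ n) ` K j i = K j (i + n)"
  unfolding K_def by (simp add: image_image funpow_add add.commute[of i])

lemma K_add_period: "K j (i + m j * k) = K j i"
proof -
  have 1: "K j (m j) = K j 0"
    using periodic[of j] by (simp add: periodic_interval_def K_def)
  have 2: "K j (i + m j) = K j i" for i
    using funpow_image_K[of i j "m j"] funpow_image_K[of i j 0] 1 by (simp add: add.commute)
  show ?thesis
  proof (induction k)
    case (Suc k)
    have "K j (i + m j * Suc k) = K j ((i + m j * k) + m j)" by (simp add: algebra_simps)
    then show ?case using 2 Suc by simp
  qed simp
qed

lemma K_mod [simp]: "K j (i mod m j) = K j i"
  using K_add_period[of j "i mod m j" "i div m j"] by (simp add: mod_mult_div_eq)

lemma K_unique:
  assumes "x \<in> K j i" "x \<in> K j i'"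
  shows "i mod m j = i' mod m j"
proof (rule ccontr)
  assume "i mod m j \<noteq> i' mod m j"
  moreover have "disjoint_family_on (K j) {..<m j}"
    using periodic[of j] by (simp add: periodic_interval_def K_def[abs_def])
  ultimately have "K j (i mod m j) \<inter> K j (i' mod m j) = {}"
    unfolding disjoint_family_on_def by (meson lessThan_iff m_pos mod_less_divisor)
  then show False using assms by auto
qed

lemma K_antimono: "j \<le> l \<Longrightarrow> K l i \<subseteq> K j i"
  unfolding K_def using gen lift_Suc_antimono_le[of I j l]
  by (simp add: generating_intervals_def image_mono)

text \<open>A point of \<open>K l 0 = K l (m l)\<close> lies in both \<open>K j 0\<close> and
  \<open>K j (m l)\<close>, so \<open>m l\<close> is congruent to 0 modulo
  \<open>m j\<close>.\<close>

lemma m_dvd: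
  assumes "j \<le> l"
  shows "m j dvd m l"
proof -
  obtain x where "x \<in> K l 0" using K_nonempty by blast
  then have "x \<in> K j 0" "x \<in> K j (m l)"
    using K_add_period[of l 0 1] K_antimono[OF assms] by auto
  then show ?thesis using K_unique by fastforce
qed

section \<open>Addresses of the points of \<open>Q\<close> and their fibres\<close>

lemma mem_Q_iff: "x \<in> Q \<longleftrightarrow> (\<forall>j. \<exists>i. x \<in> K j i)"
proof -
  have "x \<in> orb f (m j) (I j) \<longleftrightarrow> (\<exists>i. x \<in> K j i)" for j
    unfolding orb_def K_def[symmetric]
    by (metis K_mod UN_iff lessThan_iff m_pos mod_less_divisor)
  then show ?thesis by (simp add: Q_def)
qed

lemma Q_unit: "Q \<subseteq> {0..1}"
  using mem_Q_iff K_unit by blast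

lemma Q_closed: "closed Q"
  unfolding Q_def orb_def K_def[symmetric]
  by (intro closed_INT closed_UN ballI) (auto intro: compact_imp_closed[OF K_compact])

lemma \<phi>_eqI:
  assumes "x \<in> K j i"
  shows "\<phi> x j = i mod m j"
  unfolding \<phi>_def using assms by (intro the_equality) (auto dest: K_unique[OF assms])

lemma mem_K_\<phi>: "x \<in> Q \<Longrightarrow> x \<in> K j (\<phi> x j)"
  by (metis \<phi>_eqI mem_Q_iff K_mod)

lemma \<phi>_less: "x \<in> Q \<Longrightarrow> \<phi> x j < m j"
  by (metis \<phi>_eqI mem_Q_iff m_pos mod_less_divisor)

lemma mem_K_iff: "x \<in> Q \<Longrightarrow> x \<in> K j i \<longleftrightarrow> \<phi> x j = i mod m j"
  by (metis \<phi>_eqI mem_K_\<phi> K_mod)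

lemma \<phi>_coarsen: "x \<in> Q \<Longrightarrow> j \<le> l \<Longrightarrow> \<phi> x j = \<phi> x l mod m j"
  using K_antimono mem_K_\<phi> by (blast intro: \<phi>_eqI)

lemma \<phi>_in_H: "x \<in> Q \<Longrightarrow> \<phi> x \<in> H m"
  using \<phi>_less \<phi>_coarsen[OF _ le_SucI[OF order_refl], symmetric, of x] by (simp add: H_def)

lemma H_coarsen:
  assumes "r \<in> H m" "j \<le> l"
  shows "r l mod m j = r j"
  using assms(2)
proof (induction rule: dec_induct)
  case base
  then show ?case using assms(1) by (simp add: H_def)
next
  case (step l)
  have "r (Suc l) mod m l = r l" using assms(1) by (simp add: H_def)
  then show ?case using step.IH m_dvd[OF step.hyps(1)] by (metis mod_mod_cancel)
qed

text \<open>Presents a fibre as a nested intersection of compact connected sets, which yields its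
  nonemptiness and connectedness.\<close>

lemma fibre_eq:
  assumes "r \<in> H m"
  shows "{x \<in> Q. \<phi> x = r} = (\<Inter>j. K j (r j))"
proof -
  have "r j < m j" for j using assms by (simp add: H_def)
  then have "\<phi> x j = r j" if "x \<in> K j (r j)" for x j
    using that by (simp add: \<phi>_eqI[OF that])
  then have "x \<in> (\<Inter>j. K j (r j)) \<Longrightarrow> x \<in> Q \<and> \<phi> x = r" for x
    by (auto simp: mem_Q_iff fun_eq_iff)
  then show ?thesis using mem_K_\<phi> by blast
qed

text \<open>\<open>r l\<close> is congruent to \<open>r j\<close> modulo \<open>m j\<close>, so both
  name the same interval of level \<open>j\<close>.\<close>

lemma K_along_H_antimono: "r \<in> H m \<Longrightarrow> j \<le> l \<Longrightarrow> K l (r l) \<subseteq> K j (r j)"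
  by (metis H_coarsen K_antimono K_mod)

lemma \<phi>_onto: "\<phi> ` Q = H m"
proof
  show "\<phi> ` Q \<subseteq> H m" using \<phi>_in_H by blast
  show "H m \<subseteq> \<phi> ` Q"
  proof
    fix r assume r: "r \<in> H m"
    have "(\<Inter>j. K j (r j)) \<noteq> {}"
      by (rule compact_nest) (auto simp: K_compact K_nonempty dest: subsetD[OF K_along_H_antimono[OF r]])
    then show "r \<in> \<phi> ` Q" using fibre_eq[OF r] by blast
  qed
qed

lemma Q_nonempty: "Q \<noteq> {}"
proof -
  have "(\<lambda>_. 0) \<in> H m" by (simp add: H_def)
  then show ?thesis using \<phi>_onto by blast
qed

lemma
  assumes "x \<in> Q"
  shows funpow_in_Q: "(f ^^ n) x \<in> Q"
    and \<phi>_funpow: "\<phi> ((f ^^ n) x) j = (\<phi> x j + n) mod m j"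
proof -
  have "(f ^^ n) x \<in> K j (\<phi> x j + n)" for j
    using mem_K_\<phi>[OF assms] funpow_image_K by blast
  then show "(f ^^ n) x \<in> Q" "\<phi> ((f ^^ n) x) j = (\<phi> x j + n) mod m j"
    by (auto simp: mem_Q_iff intro: \<phi>_eqI)
qed

lemma visits_K:
  assumes "x \<in> Q"
  obtains n where "n \<ge> N" "(f ^^ n) x \<in> K j i"
proof
  \<comment> \<open>\<open>m j - \<phi> x j\<close> steps lead to \<open>K j 0\<close>,
    \<open>N\<close> full periods make the time late, and \<open>i\<close> further steps lead to
    \<open>K j i\<close>.\<close>
  let ?n = "N * m j + (m j - \<phi> x j) + i"
  have "N \<le> N * m j" by (simp add: Suc_leI)
  then show "?n \<ge> N" by linarith
  have "\<phi> x j + ?n = i + (N + 1) * m j"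
    using \<phi>_less[OF assms, of j] by simp
  then have "(\<phi> x j + ?n) mod m j = i mod m j" by (metis mod_mult_self1)
  then show "(f ^^ ?n) x \<in> K j i"
    using assms by (simp only: mem_K_iff funpow_in_Q \<phi>_funpow)
qed

text \<open>At a level whose period exceeds both times, the residues tell them apart. Hence no orbit
  in \<open>Q\<close> returns to a fibre.\<close>

lemma \<phi>_funpow_inj:
  assumes "x \<in> Q" "\<phi> ((f ^^ n) x) = \<phi> ((f ^^ n') x)"
  shows "n = n'"
proof -
  obtain j where j: "max n n' < m j" using m_unbounded by blast
  have "(\<phi> x j + n) mod m j = (\<phi> x j + n') mod m j"
    using assms by (metis \<phi>_funpow)
  then have "n mod m j = n' mod m j"
    using mod_add_left_cancel_nat by blast
  then show ?thesis using j by simp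
qed

section \<open>The common limit set \<open>S\<close>\<close>

lemma K_inside:
  assumes "p \<in> Q" "q \<in> Q" "s \<in> Q" "p < q" "q < s" "\<phi> p \<noteq> \<phi> q" "\<phi> q \<noteq> \<phi> s"
  obtains j i where "K j i \<subseteq> {p<..<s}"
proof -
  obtain j l where "\<phi> p j \<noteq> \<phi> q j" "\<phi> q l \<noteq> \<phi> s l"
    using assms by (metis ext)
  \<comment> \<open>Addresses that differ at some level differ at all later ones by
    \<open>\<phi>_coarsen\<close>, so one level separates \<open>q\<close> from both
    \<open>p\<close> and \<open>s\<close>.\<close>
  then have ne: "\<phi> p (max j l) \<noteq> \<phi> q (max j l)" "\<phi> s (max j l) \<noteq> \<phi> q (max j l)"
    using assms(1-3) by (metis \<phi>_coarsen max.cobounded1, metis \<phi>_coarsen max.cobounded2)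
  let ?K = "K (max j l) (\<phi> q (max j l))"
  have q: "q \<in> ?K" and ps: "p \<notin> ?K" "s \<notin> ?K"
    using assms(1-3) ne \<phi>_less[of q] by (auto simp: mem_K_iff)
  have "?K \<subseteq> {p<..<s}"
  proof
    fix t assume t: "t \<in> ?K"
    \<comment> \<open>If \<open>t \<le> p\<close>, the interval through \<open>t\<close> and
      \<open>q\<close> would contain \<open>p\<close>; likewise for \<open>s\<close>.\<close>
    have "p < t" using K_between[OF t q, of p] ps assms(4) by linarith
    moreover have "t < s" using K_between[OF q t, of s] ps assms(5) by linarith
    ultimately show "t \<in> {p<..<s}" by simp
  qed
  then show thesis by (rule that)
qed

lemma S_if_infinite:
  assumes "\<And>e. e > 0 \<Longrightarrow> infinite (\<phi> ` (Q \<inter> ball y e))"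
  shows "y \<in> S"
  unfolding S_def
proof (intro CollectI allI impI)
  fix e :: real assume "e > 0"
  \<comment> \<open>One representative per address, so that three points of \<open>B\<close> meet
    the hypotheses of \<open>K_inside\<close>.\<close>
  obtain B where B: "B \<subseteq> Q \<inter> ball y e" "inj_on \<phi> B" "\<phi> ` (Q \<inter> ball y e) = \<phi> ` B"
    using subset_image_inj[of "\<phi> ` (Q \<inter> ball y e)" \<phi> "Q \<inter> ball y e"] by auto
  have "infinite B" using assms[OF \<open>e > 0\<close>] B(3) by auto
  then obtain a b c where abc: "a \<in> B" "b \<in> B" "c \<in> B" "a < b" "b < c"
    using infinite_imp_three_less by metis
  then have "\<phi> a \<noteq> \<phi> b" "\<phi> b \<noteq> \<phi> c"
    using B(2) by (auto simp: inj_on_def)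
  then obtain j i where "K j i \<subseteq> {a<..<c}"
    using K_inside[of a b c] abc B(1) by (metis IntD1 subsetD)
  moreover have "{a<..<c} \<subseteq> ball y e"
    using subsetD[OF B(1) abc(1)] subsetD[OF B(1) abc(3)]
    by (auto simp: ball_eq_greaterThanLessThan)
  ultimately show "\<exists>j i. K j i \<subseteq> ball y e" by blast
qed

lemma omega_limit_Q:
  assumes x: "x \<in> Q"
  shows "omega_limit f x = S"
proof
  show "S \<subseteq> omega_limit f x"
  proof
    fix y assume y: "y \<in> S"
    show "y \<in> omega_limit f x"
      unfolding omega_limit_iff
    proof (intro allI impI)
      fix e :: real and N assume "e > 0"
      then obtain j i where "K j i \<subseteq> ball y e" using y by (auto simp: S_def)
      moreover obtain n where "n \<ge> N" "(f ^^ n) x \<in> K j i" using visits_K[OF x] by blast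
      ultimately show "\<exists>n\<ge>N. dist ((f ^^ n) x) y < e"
        by (metis dist_commute mem_ball subsetD)
    qed
  qed
  show "omega_limit f x \<subseteq> S"
  proof
    fix y assume y: "y \<in> omega_limit f x"
    show "y \<in> S"
    proof (rule S_if_infinite)
      fix e :: real assume "e > 0"
      let ?N = "{n. (f ^^ n) x \<in> ball y e}"
      \<comment> \<open>The orbit is near \<open>y\<close> at infinitely many times, and its
        addresses at these times are pairwise distinct.\<close>
      have "infinite ?N"
        unfolding infinite_nat_iff_unbounded_le
        using omega_limitD[OF y open_ball] \<open>e > 0\<close> by (metis centre_in_ball mem_Collect_eq)
      moreover have "inj_on (\<lambda>n. \<phi> ((f ^^ n) x)) ?N"
        using \<phi>_funpow_inj[OF x] by (auto intro: inj_onI)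
      ultimately have "infinite ((\<lambda>n. \<phi> ((f ^^ n) x)) ` ?N)"
        using finite_imageD by blast
      moreover have "(\<lambda>n. \<phi> ((f ^^ n) x)) ` ?N \<subseteq> \<phi> ` (Q \<inter> ball y e)"
        using funpow_in_Q[OF x] by blast
      ultimately show "infinite (\<phi> ` (Q \<inter> ball y e))"
        using finite_subset by blast
    qed
  qed
qed

lemma S_subset_Q: "S \<subseteq> Q"
proof -
  obtain x where "x \<in> Q" using Q_nonempty by blast
  then show ?thesis
    using omega_limit_subset_closed[OF Q_closed] funpow_in_Q omega_limit_Q by blast
qed

lemma funpow_in_S: "y \<in> S \<Longrightarrow> (f ^^ n) y \<in> S"
proof (induction n)
  case (Suc n)
  obtain x where "x \<in> Q" using Q_nonempty by blast
  then have "f ((f ^^ n) y) \<in> omega_limit f x"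
    using Suc omega_limit_Q omega_limit_forward[OF closed_atLeastAtMost f_cont f_maps] Q_unit
    by blast
  then show ?case using \<open>x \<in> Q\<close> omega_limit_Q by simp
qed simp

lemma S_nonempty: "S \<noteq> {}"
proof -
  obtain x where x: "x \<in> Q" using Q_nonempty by blast
  then have "\<forall>n. (f ^^ n) x \<in> {0..1}" using funpow_unit Q_unit by blast
  then obtain y s where "strict_mono (s :: nat \<Rightarrow> nat)" "((\<lambda>n. (f ^^ n) x) \<circ> s) \<longlonglongrightarrow> y"
    using compact_imp_seq_compact[OF compact_Icc[of 0 "1::real"]] unfolding seq_compact_def
    by metis
  then have "y \<in> omega_limit f x" by (auto simp: omega_limit_def o_def)
  then show ?thesis using omega_limit_Q[OF x] by blast
qed

text \<open>The orbit of a point of \<open>S\<close> stays in \<open>S\<close> and, lying in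
  \<open>Q\<close>, visits every \<open>K j i\<close>.\<close>

lemma S_meets_K: "S \<inter> K j i \<noteq> {}"
proof -
  obtain y where "y \<in> S" using S_nonempty by blast
  moreover from this obtain n where "(f ^^ n) y \<in> K j i"
    using visits_K S_subset_Q by (metis subsetD)
  ultimately show ?thesis using funpow_in_S by blast
qed

lemma S_closed: "closed S"
  using Q_nonempty omega_limit_Q closed_omega_limit by (metis ex_in_conv)

text \<open>The sets \<open>S \<inter> K j (r j)\<close> are compact, nonempty and decreasing, so
  they have a common point.\<close>

lemma S_in_fibre:
  assumes r: "r \<in> H m"
  obtains y where "y \<in> S" "y \<in> Q" "\<phi> y = r"
proof -
  have "(\<Inter>j. S \<inter> K j (r j)) \<noteq> {}"
    using S_meets_K by (intro compact_nest closed_Int_compact S_closed K_compact)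
      (auto dest: subsetD[OF K_along_H_antimono[OF r]])
  then obtain y where "y \<in> S" "y \<in> (\<Inter>j. K j (r j))" by auto
  then show thesis using that fibre_eq[OF r] by blast
qed

text \<open>Iterating by multiples of the period keeps a point in \<open>S \<inter> K j i\<close>,
  and the iterates are distinct by their addresses.\<close>

lemma infinite_S_K: "infinite (S \<inter> K j i)"
proof -
  obtain y where y: "y \<in> S" "y \<in> K j i" using S_meets_K by blast
  then have yQ: "y \<in> Q" using S_subset_Q by blast
  have "(f ^^ (m j * n)) y \<in> K j i" for n
    using y(2) funpow_image_K[of "m j * n" j i] K_add_period[of j i n] by auto
  then have "range (\<lambda>n. (f ^^ (m j * n)) y) \<subseteq> S \<inter> K j i"
    using funpow_in_S[OF y(1)] by blast
  moreover have "inj (\<lambda>n. (f ^^ (m j * n)) y)"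
  proof (rule injI)
    fix n n' assume "(f ^^ (m j * n)) y = (f ^^ (m j * n')) y"
    then have "m j * n = m j * n'" using \<phi>_funpow_inj[OF yQ] by metis
    then show "n = n'" using m_pos[of j] by simp
  qed
  ultimately show ?thesis using finite_subset range_inj_infinite by blast
qed

section \<open>Periodic and non-wandering points\<close>

lemma S_subset_closure_Per: "S \<subseteq> closure (Per {0..1} f)"
proof
  fix y assume y: "y \<in> S"
  show "y \<in> closure (Per {0..1} f)"
    unfolding closure_approachable
  proof (intro allI impI)
    fix e :: real assume "e > 0"
    then obtain j i where ji: "K j i \<subseteq> ball y e" using y by (auto simp: S_def)
    \<comment> \<open>\<open>f ^^ m j\<close> maps the compact interval \<open>K j i\<close> into
      itself, so it has a fixed point there, which is a periodic point near
      \<open>y\<close>.\<close>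
    have "\<exists>p\<in>K j i. (f ^^ m j) p = p"
    proof (rule brouwer[of "K j i" "f ^^ m j"])
      show "convex (K j i)" using K_connected connected_convex_1 by blast
      show "continuous_on (K j i) (f ^^ m j)"
        using funpow_cont K_unit continuous_on_subset by blast
      show "f ^^ m j \<in> K j i \<rightarrow> K j i"
        using funpow_image_K[of "m j" j i] K_add_period[of j i 1] by auto
    qed (auto simp: K_compact K_nonempty)
    then obtain p where p: "p \<in> K j i" "(f ^^ m j) p = p" by blast
    then have "p \<in> Per {0..1} f"
      using K_unit m_pos[of j] unfolding Per_def One_nat_def Suc_le_eq by blast
    then show "\<exists>p\<in>Per {0..1} f. dist p y < e"
      using p(1) ji by (metis dist_commute mem_ball subsetD)
  qed
qed

lemma S_subset_nonwandering: "S \<subseteq> nonwandering {0..1} f"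
proof
  fix y assume y: "y \<in> S"
  show "y \<in> nonwandering {0..1} f"
    unfolding nonwandering_def
  proof (intro CollectI conjI allI impI)
    show "y \<in> {0..1}" using y S_subset_Q Q_unit by blast
    fix U assume U: "openin (top_of_set {0..1}) U \<and> y \<in> U"
    then obtain e where "e > 0" "ball y e \<inter> {0..1} \<subseteq> U"
      by (auto simp: openin_contains_ball)
    moreover from this obtain j i where "K j i \<subseteq> ball y e" using y by (auto simp: S_def)
    \<comment> \<open>\<open>U\<close> contains a whole interval that \<open>f ^^ m j\<close> maps
      onto itself, so \<open>U\<close> meets its own image at time \<open>m j\<close>.\<close>
    ultimately have "K j i \<subseteq> U" using K_unit by blast
    moreover have "(f ^^ m j) ` K j i = K j i"
      using funpow_image_K[of "m j" j i] K_add_period[of j i 1] by simp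
    ultimately have "(f ^^ m j) ` U \<inter> U \<noteq> {}"
      using K_nonempty[of j i] by blast
    then show "\<exists>n\<ge>1. (f ^^ n) ` U \<inter> U \<noteq> {}"
      using m_pos[of j] unfolding One_nat_def Suc_le_eq by blast
  qed
qed

lemma fibre_connected: "r \<in> H m \<Longrightarrow> connected {x \<in> Q. \<phi> x = r}"
  unfolding fibre_eq
  by (intro connected_nest) (auto simp: K_compact K_connected dest: subsetD[OF K_along_H_antimono])

text \<open>The open interval is a neighbourhood with a single address; a return to it at a time
  \<open>n \<ge> 1\<close> would repeat an address along an orbit in \<open>Q\<close>.\<close>

lemma nonwandering_fibre:
  assumes x: "x \<in> nonwandering {0..1} f" and sub: "{a..b} \<subseteq> {z \<in> Q. \<phi> z = r}"
  shows "x \<notin> {a<..<b}"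
proof
  assume xab: "x \<in> {a<..<b}"
  have "{a<..<b} \<subseteq> {0..1}"
    using sub Q_unit greaterThanLessThan_subseteq_atLeastAtMost_iff[of a b a b] by blast
  then have "openin (top_of_set {0..1}) {a<..<b}"
    by (simp add: open_subset)
  then obtain n where n: "n \<ge> 1" "(f ^^ n) ` {a<..<b} \<inter> {a<..<b} \<noteq> {}"
    using x xab unfolding nonwandering_def by blast
  then obtain z where "z \<in> {a<..<b}" "(f ^^ n) z \<in> {a<..<b}" by blast
  then have "z \<in> Q" "\<phi> ((f ^^ n) z) = \<phi> ((f ^^ 0) z)"
    using sub by (auto simp: subset_eq)
  then show False using \<phi>_funpow_inj n(1) by fastforce
qed

text \<open>Fibres are convex, so the middle one of three such points would be interior to an
  interval of constant address.\<close>

lemma nonwandering_fibre_finite: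
  "finite {x \<in> Q \<inter> nonwandering {0..1} f. \<phi> x = r}" (is "finite ?A")
proof (rule ccontr)
  assume inf: "infinite ?A"
  obtain a b c where abc: "a \<in> ?A" "b \<in> ?A" "c \<in> ?A" "a < b" "b < c"
    by (rule infinite_imp_three_less[OF inf])
  then have "r \<in> H m" using \<phi>_in_H by auto
  then have "{a..c} \<subseteq> {x \<in> Q. \<phi> x = r}"
    using connected_contains_Icc[OF fibre_connected] abc by auto
  then show False using nonwandering_fibre[of b a c r] abc by auto
qed

text \<open>Near a point of \<open>S\<close> lies some \<open>K j i\<close>, which holds infinitely
  many points of \<open>S\<close>. Conversely, each fibre has finitely many non-wandering points, so
  infinitely many of them near \<open>y\<close> have infinitely many addresses.\<close>

lemma S_eq_limit_points: "S = {y. y islimpt (Q \<inter> nonwandering {0..1} f)}"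
proof (intro equalityI subsetI CollectI)
  fix y assume y: "y \<in> S"
  show "y islimpt (Q \<inter> nonwandering {0..1} f)"
    unfolding islimpt_eq_infinite_ball
  proof (intro allI impI)
    fix e :: real assume "e > 0"
    then obtain j i where "K j i \<subseteq> ball y e" using y by (auto simp: S_def)
    then have "S \<inter> K j i \<subseteq> (Q \<inter> nonwandering {0..1} f) \<inter> ball y e"
      using S_subset_Q S_subset_nonwandering by blast
    then show "infinite ((Q \<inter> nonwandering {0..1} f) \<inter> ball y e)"
      using infinite_S_K finite_subset by blast
  qed
next
  fix y assume "y \<in> {y. y islimpt (Q \<inter> nonwandering {0..1} f)}"
  then have y: "y islimpt (Q \<inter> nonwandering {0..1} f)" by simp
  show "y \<in> S"
  proof (rule S_if_infinite)
    fix e :: real assume "e > 0"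
    let ?A = "Q \<inter> nonwandering {0..1} f \<inter> ball y e"
    have "infinite ?A" using y \<open>e > 0\<close> by (simp add: islimpt_eq_infinite_ball)
    moreover have "?A \<subseteq> (\<Union>r\<in>\<phi> ` ?A. {x \<in> Q \<inter> nonwandering {0..1} f. \<phi> x = r})" by blast
    ultimately have "infinite (\<phi> ` ?A)"
      using nonwandering_fibre_finite by (meson finite_UN_I finite_subset)
    moreover have "\<phi> ` ?A \<subseteq> \<phi> ` (Q \<inter> ball y e)" by blast
    ultimately show "infinite (\<phi> ` (Q \<inter> ball y e))" using finite_subset by blast
  qed
qed

lemma omega_limit_meets_Q:
  assumes z: "z \<in> {0..1}" and meets: "omega_limit f z \<inter> Q \<noteq> {}"
  shows "S \<subseteq> omega_limit f z" "omega_limit f z \<subseteq> Q"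
proof -
  obtain q where q: "q \<in> omega_limit f z" "q \<in> Q" using meets by blast
  have "(f ^^ n) q \<in> omega_limit f z" for n
    using q(1) by (induction n) (auto intro: omega_limit_forward[OF _ f_cont f_maps z])
  then have "omega_limit f q \<subseteq> omega_limit f z"
    by (intro omega_limit_subset_closed closed_omega_limit)
  then show S: "S \<subseteq> omega_limit f z" using omega_limit_Q[OF q(2)] by simp
  have "omega_limit f z \<subseteq> (\<Union>i<m j. K j i)" for j
  proof -
    \<comment> \<open>The middle point is a limit point of the orbit of \<open>z\<close>, and the
      open interval between the outer two lies in \<open>K j 0\<close>. So the orbit enters
      \<open>K j 0\<close>, and from then on it stays in the cycle of level
      \<open>j\<close>.\<close>
    obtain a b c where abc: "a \<in> S \<inter> K j 0" "b \<in> S \<inter> K j 0" "c \<in> S \<inter> K j 0" "a < b" "b < c"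
      using infinite_imp_three_less[OF infinite_S_K] by metis
    then have "b \<in> omega_limit f z" "b \<in> {a<..<c}" using S by auto
    then obtain n where "(f ^^ n) z \<in> {a<..<c}"
      using omega_limitD open_greaterThanLessThan by metis
    then have n: "(f ^^ n) z \<in> K j 0" using abc K_between[of a j 0 c] by auto
    show ?thesis
    proof (rule omega_limit_subset_closed)
      show "closed (\<Union>i<m j. K j i)"
        by (intro closed_UN ballI) (auto intro: compact_imp_closed K_compact)
      fix k assume "n \<le> k"
      then have "(f ^^ k) z = (f ^^ (k - n)) ((f ^^ n) z)"
        by (metis comp_apply funpow_add le_add_diff_inverse2)
      then have "(f ^^ k) z \<in> K j ((k - n) mod m j)"
        using n funpow_image_K[of "k - n" j 0] by auto
      then show "(f ^^ k) z \<in> (\<Union>i<m j. K j i)"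
        by (meson UN_I lessThan_iff m_pos mod_less_divisor)
    qed
  qed
  then show "omega_limit f z \<subseteq> Q" by (force simp: mem_Q_iff)
qed

section \<open>Continuity of \<open>\<phi>\<close> and connected components of
  \<open>Q\<close>\<close>

lemma openin_\<phi>_eq: "openin (top_of_set Q) {x \<in> Q. \<phi> x j = i}"
proof (cases "i < m j")
  case True
  \<comment> \<open>The other intervals of level \<open>j\<close> are finitely many closed sets, so
    removing them leaves a relatively open set.\<close>
  have "{x \<in> Q. \<phi> x j = i} = Q - (\<Union>k\<in>{..<m j} - {i}. K j k)"
    using True \<phi>_less by (auto simp: mem_K_iff)
  moreover have "closed (\<Union>k\<in>{..<m j} - {i}. K j k)"
    by (intro closed_UN ballI) (auto intro: compact_imp_closed K_compact)
  ultimately show ?thesis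
    by (metis Diff_eq openin_open open_Compl)
next
  case False
  then have "{x \<in> Q. \<phi> x j = i} = {}" using \<phi>_less by auto
  then show ?thesis by (metis openin_empty)
qed

lemma openin_\<phi>_mem: "openin (top_of_set Q) {x \<in> Q. \<phi> x j \<in> A}"
proof -
  have "{x \<in> Q. \<phi> x j \<in> A} = (\<Union>i\<in>A. {x \<in> Q. \<phi> x j = i})" by blast
  then show ?thesis using openin_\<phi>_eq by (metis (no_types, lifting) openin_Union imageE)
qed

lemma \<phi>_continuous: "continuous_map (top_of_set Q) (H_topology m) \<phi>"
  unfolding H_topology_def continuous_map_in_subtopology continuous_map_componentwise_UNIV
  using \<phi>_in_H \<phi>_less openin_\<phi>_mem by (auto simp: continuous_map_def)

lemma fibre_component:
  assumes r: "r \<in> H m"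
  shows "{x \<in> Q. \<phi> x = r} \<in> components Q"
  unfolding in_components_maximal
proof (intro conjI allI impI)
  obtain x where x: "x \<in> Q" "\<phi> x = r" using \<phi>_onto[symmetric] r by auto
  then show "{x \<in> Q. \<phi> x = r} \<noteq> {}" by blast
  show "connected {x \<in> Q. \<phi> x = r}" using r by (rule fibre_connected)
  fix D assume D: "D \<noteq> {} \<and> {x \<in> Q. \<phi> x = r} \<subseteq> D \<and> D \<subseteq> Q \<and> connected D"
  have "\<phi> y j = \<phi> x j" if "y \<in> D" for y j
  proof -
    let ?E = "\<lambda>A. {z \<in> D. \<phi> z j \<in> A}"
    have E: "openin (top_of_set D) (?E A)" for A
    proof -
      obtain W where "open W" "{z \<in> Q. \<phi> z j \<in> A} = Q \<inter> W"
        using openin_\<phi>_mem[of j A] unfolding openin_open by blast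
      then have "open W" "?E A = D \<inter> W" using D by blast+
      then show ?thesis unfolding openin_open by blast
    qed
    \<comment> \<open>Both sets are open in the connected set \<open>D\<close> and cover it. The
      first contains \<open>x\<close>, so the coordinate is constant on \<open>D\<close>.\<close>
    have "?E {\<phi> x j} = {} \<or> ?E (- {\<phi> x j}) = {}"
    proof (rule ccontr)
      assume "\<not> ?thesis"
      then have "\<not> connected D"
        unfolding connected_openin not_not using E[of "{\<phi> x j}"] E[of "- {\<phi> x j}"]
        by - (rule exI[of _ "?E {\<phi> x j}"], rule exI[of _ "?E (- {\<phi> x j})"], auto)
      then show False using D by blast
    qed
    then show ?thesis using that x D by blast
  qed
  then show "D = {x \<in> Q. \<phi> x = r}" using D x(2) by (auto simp: fun_eq_iff)
qed auto

section \<open>Entropy\<close>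

lemma card_long_le:
  assumes "\<epsilon> > 0"
    and long: "\<And>s. s \<in> B \<Longrightarrow> s < m j \<and> (\<exists>a\<in>K j s. \<exists>b\<in>K j s. b - a > \<epsilon>)"
  shows "card B \<le> nat \<lfloor>1 / \<epsilon>\<rfloor> + 1" (is "_ \<le> ?P")
proof -
  \<comment> \<open>A long interval contains a multiple of \<open>\<epsilon>\<close>.\<close>
  have "\<exists>c<?P. \<epsilon> * real c \<in> K j s" if s: "s \<in> B" for s
  proof -
    obtain a b where ab: "a \<in> K j s" "b \<in> K j s" "b - a > \<epsilon>" using long[OF s] by blast
    then have "0 \<le> b" "b \<le> 1" using K_unit[of j s] by auto
    \<comment> \<open>The largest multiple of \<epsilon> not above \<open>b\<close>; it exceeds
      \<open>b - \<epsilon>\<close>, hence also \<open>a\<close>.\<close>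
    define c where "c = nat \<lfloor>b / \<epsilon>\<rfloor>"
    have "b / \<epsilon> \<ge> 0" "b / \<epsilon> \<le> 1 / \<epsilon>"
      using \<open>0 \<le> b\<close> \<open>b \<le> 1\<close> assms by (auto simp: divide_right_mono)
    then have "c < ?P" unfolding c_def by (simp add: floor_mono nat_mono le_imp_less_Suc)
    have "real c = of_int \<lfloor>b / \<epsilon>\<rfloor>" using \<open>b / \<epsilon> \<ge> 0\<close> unfolding c_def by simp
    then have "real c \<le> b / \<epsilon>" "b / \<epsilon> < real c + 1" by linarith+
    then have "\<epsilon> * real c \<le> b" "b < \<epsilon> * real c + \<epsilon>"
      using assms by (auto simp: field_simps)
    then have "\<epsilon> * real c \<in> K j s" using ab K_between[OF ab(1,2)] by simp
    with \<open>c < ?P\<close> show ?thesis by blast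
  qed
  then obtain c where c: "\<And>s. s \<in> B \<Longrightarrow> c s < ?P \<and> \<epsilon> * real (c s) \<in> K j s"
    by metis
  \<comment> \<open>Distinct indices below \<open>m j\<close> have disjoint intervals, so they use
    distinct multiples of \<epsilon>.\<close>
  have "inj_on c B"
  proof (rule inj_onI)
    fix s t assume st: "s \<in> B" "t \<in> B" "c s = c t"
    then have "s mod m j = t mod m j" using c K_unique by metis
    then show "s = t" using st long by simp
  qed
  moreover have "c ` B \<subseteq> {..<?P}" using c by blast
  ultimately have "card B \<le> card {..<?P}" by (intro card_inj_on_le) auto
  then show ?thesis by simp
qed

text \<open>A point is encoded by its interval of level \<open>j\<close> and, at each time spent in
  a long interval, by the cell of width \<epsilon> that it occupies. There are \<open>m j\<close>
  starting intervals, at most \<open>P\<close> cells, and at most \<open>P * (n div m j + 1)\<close>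
  recorded times.\<close>

lemma card_separated_le:
  assumes \<epsilon>: "\<epsilon> > 0" and sep: "dyn_separated Q f n \<epsilon> E" and "P = nat \<lfloor>1 / \<epsilon>\<rfloor> + 1"
  shows "card E \<le> m j * P ^ (P * (n div m j + 1))"
proof -
  define B where "B = {s. s < m j \<and> (\<exists>a\<in>K j s. \<exists>b\<in>K j s. b - a > \<epsilon>)}"
  have B: "finite B" "card B \<le> P"
    using card_long_le[OF \<epsilon>, of B j] unfolding assms(3) by (auto simp: B_def)
  \<comment> \<open>The times below \<open>n\<close> at which an orbit starting in
    \<open>K j i\<close> is in a long interval.\<close>
  define T where "T i = {t. t < n \<and> (i + t) mod m j \<in> B}" for i
  define C where "C = (SIGMA i:{..<m j}. T i \<rightarrow>\<^sub>E {..<P})"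
  define code where "code x = (\<phi> x j, \<lambda>t\<in>T (\<phi> x j). nat \<lfloor>(f ^^ t) x / \<epsilon>\<rfloor>)" for x
  have T: "finite (T i)" "card (T i) \<le> P * (n div m j + 1)" for i
  proof -
    show "finite (T i)" unfolding T_def by simp
    \<comment> \<open>A time is determined by its residue and its block of length
      \<open>m j\<close>. Times below \<open>n\<close> meet at most \<open>n div m j + 1\<close>
      blocks, and a block holds at most one visit to each long interval.\<close>
    have "inj_on (\<lambda>t. ((i + t) mod m j, t div m j)) (T i)"
    proof (rule inj_onI, clarify)
      fix t t' assume "(i + t) mod m j = (i + t') mod m j" "t div m j = t' div m j"
      then have "t mod m j = t' mod m j"
        using mod_add_left_cancel_nat by blast
      then show "t = t'" using \<open>t div m j = t' div m j\<close> by (metis div_mult_mod_eq)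
    qed
    moreover have "(\<lambda>t. ((i + t) mod m j, t div m j)) ` T i \<subseteq> B \<times> {..n div m j}"
      unfolding T_def by (auto intro: div_le_mono)
    ultimately have "card (T i) \<le> card (B \<times> {..n div m j})"
      using B(1) by (intro card_inj_on_le) auto
    also have "\<dots> \<le> P * (n div m j + 1)"
      using B(2) by (simp add: card_cartesian_product del: mult_Suc_right)
    finally show "card (T i) \<le> P * (n div m j + 1)" .
  qed
  have EQ: "E \<subseteq> Q" using sep by (simp add: dyn_separated_def)
  have "code ` E \<subseteq> C"
  proof
    fix p assume "p \<in> code ` E"
    then obtain x where x: "x \<in> Q" "p = code x" using EQ by blast
    have "nat \<lfloor>(f ^^ t) x / \<epsilon>\<rfloor> < P" for t
    proof -
      have "(f ^^ t) x \<le> 1" using funpow_unit x Q_unit by (metis atLeastAtMost_iff subsetD)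
      then have "(f ^^ t) x / \<epsilon> \<le> 1 / \<epsilon>" using \<epsilon> by (simp add: divide_right_mono)
      then show ?thesis unfolding assms(3) by (simp add: floor_mono nat_mono le_imp_less_Suc)
    qed
    then show "p \<in> C" using x \<phi>_less by (auto simp: C_def code_def)
  qed
  moreover have "inj_on code E"
  proof (rule inj_onI, rule ccontr)
    fix x y assume xy: "x \<in> E" "y \<in> E" "code x = code y" "x \<noteq> y"
    then obtain t where t: "t < n" "dist ((f ^^ t) x) ((f ^^ t) y) > \<epsilon>"
      using sep unfolding dyn_separated_def by blast
    have Q: "x \<in> Q" "y \<in> Q" using xy EQ by auto
    have same: "\<phi> y j = \<phi> x j" using xy(3) by (simp add: code_def)
    \<comment> \<open>Equal starting intervals keep both orbits in a common interval of level
      \<open>j\<close>. At time \<open>t\<close> they are more than \<epsilon> apart, so this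
      interval is long and \<open>t\<close> is a recorded time.\<close>
    let ?s = "(\<phi> x j + t) mod m j"
    have "(f ^^ t) x \<in> K j ?s" "(f ^^ t) y \<in> K j ?s"
      using Q same by (simp_all add: mem_K_iff funpow_in_Q \<phi>_funpow del: K_mod)
    then have "?s \<in> B"
      using t(2) unfolding B_def dist_real_def by (cases "(f ^^ t) x \<le> (f ^^ t) y") auto
    then have "t \<in> T (\<phi> x j)" using t(1) by (simp add: T_def)
    moreover have "snd (code x) t = snd (code y) t"
      using xy(3) by simp
    ultimately have "nat \<lfloor>(f ^^ t) x / \<epsilon>\<rfloor> = nat \<lfloor>(f ^^ t) y / \<epsilon>\<rfloor>"
      by (simp add: code_def same)
    \<comment> \<open>For nonnegative positions \<open>nat\<close> loses no information, so equal
      codes mean a common cell.\<close>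
    moreover have "(f ^^ t) x / \<epsilon> \<ge> 0" "(f ^^ t) y / \<epsilon> \<ge> 0"
      using funpow_unit[of x t] funpow_unit[of y t] Q Q_unit \<epsilon> by auto
    ultimately have "\<lfloor>(f ^^ t) x / \<epsilon>\<rfloor> = \<lfloor>(f ^^ t) y / \<epsilon>\<rfloor>"
      by (metis eq_nat_nat_iff zero_le_floor)
    then have "\<bar>(f ^^ t) x / \<epsilon> - (f ^^ t) y / \<epsilon>\<bar> < 1" by linarith
    then have "\<bar>(f ^^ t) x - (f ^^ t) y\<bar> < \<epsilon>"
      using \<epsilon> by (simp add: diff_divide_distrib[symmetric] field_simps)
    then show False using t(2) by (simp add: dist_real_def)
  qed
  moreover have "finite C"
    unfolding C_def using T(1) by (intro finite_SigmaI finite_PiE) auto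
  ultimately have "card E \<le> card C" by (intro card_inj_on_le) auto
  also have "card C = (\<Sum>i<m j. P ^ card (T i))"
    unfolding C_def using T(1) by (simp add: card_PiE finite_PiE)
  also have "\<dots> \<le> (\<Sum>i<m j. P ^ (P * (n div m j + 1)))"
    using T(2) assms(3) by (intro sum_mono power_increasing) auto
  also have "\<dots> = m j * P ^ (P * (n div m j + 1))" by simp
  finally show ?thesis .
qed

text \<open>\<epsilon> fixes \<open>P\<close> and \<open>c\<close>, while the level \<open>j\<close>
  is free. For fixed \<open>j\<close> the bound of \<open>card_separated_le\<close> grows at rate at
  most \<open>c / m j\<close>, which is small when \<open>m j\<close> is large.\<close>

lemma growth_rate_le:
  assumes \<epsilon>: "\<epsilon> > 0" and \<eta>: "\<eta> > 0"
  shows "limsup (\<lambda>n. SUP E\<in>{E. finite E \<and> dyn_separated Q f n \<epsilon> E}.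
    ereal (ln (real (card E)) / real n)) \<le> ereal \<eta>"
proof (rule Limsup_bounded)
  define P where "P = nat \<lfloor>1 / \<epsilon>\<rfloor> + 1"
  define c where "c = real P * ln (real P)"
  have c: "c \<ge> 0" unfolding c_def P_def by simp
  obtain N :: nat where N: "c < real N * (\<eta> / 2)"
    using reals_Archimedean3[of "\<eta> / 2"] \<eta> by auto
  obtain j where "N < m j" using m_unbounded by blast
  then have "c < real (m j) * (\<eta> / 2)"
    using N \<eta> by (smt (verit) mult_right_mono of_nat_less_iff half_gt_zero)
  then have j: "c / real (m j) < \<eta> / 2" by (simp add: field_simps)
  \<comment> \<open>Collects the terms that do not grow with \<open>n\<close>: the choice of the
    starting interval and the one extra block.\<close>
  define d where "d = ln (real (m j)) + c"
  have "d \<ge> 0" using c m_pos[of j] unfolding d_def by (simp add: Suc_leI)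
  have bound: "ln (real (card E)) / real n \<le> c / real (m j) + d / real n"
    if "n > 0" "finite E" "dyn_separated Q f n \<epsilon> E" for n E
  proof (cases "E = {}")
    \<comment> \<open>Here \<open>ln 0 = 0\<close>, so nonnegativity of \<open>c\<close> and
      \<open>d\<close> is enough.\<close>
    case True
    then show ?thesis using c \<open>d \<ge> 0\<close> by simp
  next
    case False
    define q where "q = P * (n div m j + 1)"
    have "P > 0" by (simp add: P_def)
    have "real (card E) \<le> real (m j * P ^ q)"
      using card_separated_le[OF \<epsilon> that(3) P_def] unfolding q_def by (intro of_nat_mono)
    moreover have "real (card E) > 0" using False that(2) by (simp add: card_gt_0_iff)
    ultimately have "ln (real (card E)) \<le> ln (real (m j * P ^ q))"
      by (simp only: ln_le_cancel_iff)
    also have "\<dots> = ln (real (m j)) + real q * ln (real P)"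
      using \<open>P > 0\<close> by (simp add: ln_mult ln_realpow)
    also have "real q * ln (real P) = c * (real (n div m j) + 1)"
      by (simp add: c_def q_def algebra_simps)
    also have "\<dots> \<le> c * (real n / real (m j) + 1)"
      using c by (intro mult_left_mono add_right_mono) (simp_all add: of_nat_div_le_of_nat)
    finally have "ln (real (card E)) \<le> c * (real n / real (m j)) + d"
      by (simp add: d_def algebra_simps)
    then have "ln (real (card E)) / real n \<le> (c * (real n / real (m j)) + d) / real n"
      by (rule divide_right_mono) simp
    also have "\<dots> = c / real (m j) + d / real n"
      using that(1) by (simp add: field_simps)
    finally show ?thesis .
  qed
  have "(\<lambda>n. d / real n) \<longlonglongrightarrow> 0" by (rule lim_const_over_n)
  then have "eventually (\<lambda>n. d / real n < \<eta> / 2) sequentially"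
    using \<eta> by (intro order_tendstoD(2)) auto
  then show "eventually (\<lambda>n. (SUP E\<in>{E. finite E \<and> dyn_separated Q f n \<epsilon> E}.
      ereal (ln (real (card E)) / real n)) \<le> ereal \<eta>) sequentially"
    using eventually_gt_at_top[of 0]
  proof eventually_elim
    case (elim n)
    show ?case
    proof (rule SUP_least)
      fix E assume "E \<in> {E. finite E \<and> dyn_separated Q f n \<epsilon> E}"
      then have "ln (real (card E)) / real n \<le> c / real (m j) + d / real n"
        using bound elim(2) by blast
      then have "ln (real (card E)) / real n \<le> \<eta>" using j elim(1) by linarith
      then show "ereal (ln (real (card E)) / real n) \<le> ereal \<eta>" by simp
    qed
  qed
qed

lemma entropy_zero: "topological_entropy Q f = 0"
proof -
  define g :: "real \<Rightarrow> nat \<Rightarrow> ereal" where "g = (\<lambda>\<epsilon> n.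
    SUP E\<in>{E. finite E \<and> dyn_separated Q f n \<epsilon> E}. ereal (ln (real (card E)) / real n))"
  have entropy: "topological_entropy Q f = (SUP \<epsilon>\<in>{0<..}. limsup (g \<epsilon>))"
    unfolding topological_entropy_def g_def ..
  have "limsup (g \<epsilon>) \<le> 0" if "\<epsilon> > 0" for \<epsilon>
  proof (rule ereal_le_epsilon2)
    fix e :: real assume "e > 0"
    then have "limsup (g \<epsilon>) \<le> ereal e"
      unfolding g_def using that by (intro growth_rate_le)
    then show "limsup (g \<epsilon>) \<le> 0 + ereal e" by simp
  qed
  then have "topological_entropy Q f \<le> 0"
    unfolding entropy by (intro SUP_least) simp
  \<comment> \<open>The empty separated set contributes \<open>ln 0 = 0\<close>.\<close>
  moreover have "0 \<le> g 1 n" for n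
    unfolding g_def by (rule SUP_upper2[of "{}"]) (simp_all add: dyn_separated_def)
  then have "0 \<le> limsup (g 1)"
    by (intro le_Limsup always_eventually allI) simp_all
  then have "0 \<le> topological_entropy Q f"
    unfolding entropy by (rule SUP_upper2[rotated]) simp
  ultimately show ?thesis by (rule antisym)
qed

end

theorem theorem3p1:
  fixes f :: "real \<Rightarrow> real" and I :: "nat \<Rightarrow> real set" and m :: "nat \<Rightarrow> nat"
    and Q S_p S_omega S_Omega :: "real set"
  assumes f_cont: "continuous_on {0..1} f"
    and f_maps: "f ` {0..1} \<subseteq> {0..1}"
    and gen: "generating_intervals f I m"
    and Q_eq: "Q = (\<Inter>j. orb f (m j) (I j))"
    and S_p_eq: "S_p = Q \<inter> closure (Per {0..1} f)"
    and S_omega_eq: "S_omega = Q \<inter> omega_set {0..1} f"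
    and S_Omega_eq: "S_Omega = Q \<inter> nonwandering {0..1} f"
  shows "\<exists>\<phi> :: real \<Rightarrow> nat \<Rightarrow> nat.
    continuous_map (top_of_set Q) (H_topology m) \<phi> \<and>
    (\<forall>x\<in>Q. f x \<in> Q \<and> translation m (\<phi> x) = \<phi> (f x)) \<and> \<phi> ` Q = H m \<and>
    (\<exists>S.
      (S \<subseteq> S_p \<and> (\<forall>x\<in>Q. omega_limit f x = S)) \<and>
      (\<forall>S'. S' \<subseteq> S_p \<and> (\<forall>x\<in>Q. omega_limit f x = S') \<longrightarrow> S' = S) \<and>
      S = {x. x islimpt S_Omega} \<and> minimal_on S f \<and>
      (\<forall>z\<in>{0..1}. omega_limit f z \<inter> Q \<noteq> {} \<longrightarrow>
         S \<subseteq> omega_limit f z \<and> omega_limit f z \<subseteq> S_omega) \<and>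
      (\<forall>r\<in>H m. \<forall>J. J = {x \<in> Q. \<phi> x = r} \<longrightarrow>
         J \<in> components Q \<and>
         (\<forall>a. J = {a} \<longrightarrow> a \<in> S) \<and>
         (\<forall>a b. a < b \<and> J = {a..b} \<longrightarrow>
            S \<inter> J \<noteq> {} \<and> S \<inter> J \<subseteq> S_Omega \<inter> J \<and> S_Omega \<inter> J \<subseteq> {a, b})) \<and>
      countable (S_Omega - S) \<and> (\<forall>x\<in>S_Omega - S. x isolated_in S_Omega)) \<and>
    topological_entropy Q f = 0"
proof -
  interpret solenoidal f I m
    using f_cont f_maps gen by unfold_locales
  have Q: "solenoidal.Q f I m = Q"
    using Q_eq by (simp add: Q_def)
  have limpt: "S = {x. x islimpt S_Omega}"
    using S_eq_limit_points unfolding Q S_Omega_eq .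
  have S_S_Omega: "S \<subseteq> S_Omega"
    using S_subset_Q S_subset_nonwandering unfolding Q S_Omega_eq by blast
  have "continuous_map (top_of_set Q) (H_topology m) \<phi>"
    using \<phi>_continuous unfolding Q .
  moreover have "\<forall>x\<in>Q. f x \<in> Q \<and> translation m (\<phi> x) = \<phi> (f x)"
    using funpow_in_Q[of _ 1] \<phi>_funpow[of _ 1] unfolding Q by (auto simp: translation_def fun_eq_iff)
  moreover have "\<phi> ` Q = H m"
    using \<phi>_onto unfolding Q .
  moreover have "S \<subseteq> S_p"
    using S_subset_Q S_subset_closure_Per unfolding Q S_p_eq by blast
  moreover have omega: "\<forall>x\<in>Q. omega_limit f x = S"
    using omega_limit_Q unfolding Q by blast
  \<comment> \<open>\<open>Q\<close> has a point, and its limit set is both \<open>S'\<close> and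
    \<open>S\<close>.\<close>
  moreover have "\<forall>S'. S' \<subseteq> S_p \<and> (\<forall>x\<in>Q. omega_limit f x = S') \<longrightarrow> S' = S"
    using omega Q_nonempty unfolding Q by blast
  moreover note limpt
  moreover have "minimal_on S f"
    using funpow_in_S[of _ 1] omega S_subset_Q unfolding minimal_on_def Q by auto
  moreover have "\<forall>z\<in>{0..1}. omega_limit f z \<inter> Q \<noteq> {} \<longrightarrow>
      S \<subseteq> omega_limit f z \<and> omega_limit f z \<subseteq> S_omega"
    using omega_limit_meets_Q unfolding Q S_omega_eq omega_set_def by blast
  moreover have "\<forall>r\<in>H m. \<forall>J. J = {x \<in> Q. \<phi> x = r} \<longrightarrow>
      J \<in> components Q \<and> (\<forall>a. J = {a} \<longrightarrow> a \<in> S) \<and>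
      (\<forall>a b. a < b \<and> J = {a..b} \<longrightarrow>
        S \<inter> J \<noteq> {} \<and> S \<inter> J \<subseteq> S_Omega \<inter> J \<and> S_Omega \<inter> J \<subseteq> {a, b})"
  proof (intro ballI allI impI)
    fix r J assume r: "r \<in> H m" and J: "J = {x \<in> Q. \<phi> x = r}"
    have comp: "J \<in> components Q"
      using fibre_component[OF r] unfolding Q J .
    \<comment> \<open>This also settles one-point fibres: their only point must lie in
      \<open>S\<close>.\<close>
    have meets: "S \<inter> J \<noteq> {}"
      using S_in_fibre[OF r] unfolding Q J by blast
    have ends: "S_Omega \<inter> J \<subseteq> {a, b}" if "J = {a..b}" for a b
    proof
      fix x assume x: "x \<in> S_Omega \<inter> J"
      moreover have "x \<notin> {a<..<b}"
        using nonwandering_fibre[of x a b r] x that unfolding Q J S_Omega_eq by blast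
      ultimately show "x \<in> {a, b}" using that by auto
    qed
    show "J \<in> components Q \<and> (\<forall>a. J = {a} \<longrightarrow> a \<in> S) \<and>
      (\<forall>a b. a < b \<and> J = {a..b} \<longrightarrow>
        S \<inter> J \<noteq> {} \<and> S \<inter> J \<subseteq> S_Omega \<inter> J \<and> S_Omega \<inter> J \<subseteq> {a, b})"
      using comp meets ends S_S_Omega by blast
  qed
  \<comment> \<open>Since \<open>S\<close> consists of all limit points of \<open>S_Omega\<close>, a
    point of \<open>S_Omega\<close> outside \<open>S\<close> is not a limit point.\<close>
  moreover have isolated: "\<forall>x\<in>S_Omega - S. x isolated_in S_Omega"
    unfolding limpt isolated_in_islimpt_iff by blast
  moreover have "countable (S_Omega - S)"
    using isolated by (intro countable_subset[OF _ countable_isolated_points[of S_Omega]]) blast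
  moreover have "topological_entropy Q f = 0"
    using entropy_zero unfolding Q .
  ultimately show ?thesis
    by - (rule exI[of _ \<phi>], intro conjI exI[of _ S]; assumption)
qed

end
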